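(* Let $P_{n_1},\dots,P_{n_r}$ be oriented paths, where $P_{n_i}$ has vertices $a_{i,1}\to a_{i,2}\to\cdots\to a_{i,n_i}$. Let $G=\square_{i=1}^r P_{n_i}$ carry a simple pebbling. Then $G\cong [S_G]$ as directed graphs.
   Context: The Cartesian product $G=\square_{i=1}^r P_{n_i}$ has vertex set all tuples $(x_1,\dots,x_r)$ with $x_i\in\{a_{i,1},\dots,a_{i,n_i}\}$, and a directed edge from $(x_1,\dots,x_r)$ to $(y_1,\dots,y_r)$ iff the tuples agree in all coordinates except one coordinate $i$, where $x_i=a_{i,j}$ and $y_i=a_{i,j+1}$ for some $j$. A simple pebbling on $G$ is a pebbling assignment such that: for each $i$, the vertex whose $i$-th coordinate is $a_{i,1}$ and whose $l$-th coordinate is $a_{l,n_l}$ for all $l\neq i$ has two or three pebbles; for each $i$ and each $1<j<n_i$, the vertex whose $i$-th coordinate is $a_{i,j}$ and whose other coordinates are $a_{l,n_l}$ ($l\neq i$) has exactly one pebble; the vertex $(a_{1,n_1},\dots,a_{r,n_r})$ has any number of pebbles; and every remaining vertex has zero or one pebble. A pebbling move along an edge $(v,w)$ (allowed when $v$ has at least two pebbles) removes two pebbles from $v$ and adds one pebble to $w$. The assignment graph $[S_G]$ is the directed graph whose vertices are all assignments obtainable from $(S_G)$ by finite sequences of pebbling moves (including $(S_G)$ itself), with a directed edge from $A$ to $B$ whenever $B$ is obtained from $A$ by a single pebbling move. *)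

theory Defs
  imports
    "HOL-Library.FuncSet"
    "Graph_Theory.Pair_Digraph"
    "Graph_Theory.Digraph_Isomorphism"
begin

definition oriented_path :: "(nat \<Rightarrow> 'a) \<Rightarrow> nat \<Rightarrow> 'a pair_pre_digraph" where
  "oriented_path a n =
    \<lparr> pverts = a ` {1..n},
      parcs = {(a j, a (Suc j)) | j. 1 \<le> j \<and> j < n} \<rparr>"

text \<open>Tuples are extensional functions on the index set, so that each tuple has exactly one
  representation.\<close>

definition cartesian_product ::
    "'i set \<Rightarrow> ('i \<Rightarrow> 'a pair_pre_digraph) \<Rightarrow> ('i \<Rightarrow> 'a) pair_pre_digraph" where
  "cartesian_product I D =
    \<lparr> pverts = (\<Pi>\<^sub>E i\<in>I. pverts (D i)),
      parcs = {(x, y). x \<in> (\<Pi>\<^sub>E i\<in>I. pverts (D i)) \<and> y \<in> (\<Pi>\<^sub>E i\<in>I. pverts (D i)) \<and>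
        (\<exists>i\<in>I. (x i, y i) \<in> parcs (D i) \<and> (\<forall>l\<in>I - {i}. x l = y l))} \<rparr>"

definition path_product ::
    "nat \<Rightarrow> (nat \<Rightarrow> nat) \<Rightarrow> (nat \<Rightarrow> nat \<Rightarrow> 'a) \<Rightarrow> (nat \<Rightarrow> 'a) pair_pre_digraph" where
  "path_product r n a = cartesian_product {1..r} (\<lambda>i. oriented_path (a i) (n i))"

text \<open>An assignment is a function on the vertex set; it is extended by 0 so that equality of
  assignments is equality of functions.\<close>

definition pebbling_assignment :: "'v pair_pre_digraph \<Rightarrow> ('v \<Rightarrow> nat) \<Rightarrow> bool" where
  "pebbling_assignment G A \<longleftrightarrow> (\<forall>v. v \<notin> pverts G \<longrightarrow> A v = 0)"

definition pebbling_move :: "'v pair_pre_digraph \<Rightarrow> ('v \<Rightarrow> nat) \<Rightarrow> ('v \<Rightarrow> nat) \<Rightarrow> bool" where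
  "pebbling_move G A B \<longleftrightarrow>
    (\<exists>(v, w) \<in> parcs G. 2 \<le> A v \<and>
      (let A' = A(v := A v - 2) in B = A'(w := A' w + 1)))"

definition assignment_graph ::
    "'v pair_pre_digraph \<Rightarrow> ('v \<Rightarrow> nat) \<Rightarrow> ('v \<Rightarrow> nat) pair_pre_digraph" where
  "assignment_graph G S =
    \<lparr> pverts = {A. (pebbling_move G)\<^sup>*\<^sup>* S A},
      parcs = {(A, B). (pebbling_move G)\<^sup>*\<^sup>* S A \<and> (pebbling_move G)\<^sup>*\<^sup>* S B \<and>
        pebbling_move G A B} \<rparr>"

definition top_vertex :: "nat \<Rightarrow> (nat \<Rightarrow> nat) \<Rightarrow> (nat \<Rightarrow> nat \<Rightarrow> 'a) \<Rightarrow> (nat \<Rightarrow> 'a)" where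
  "top_vertex r n a = (\<lambda>l\<in>{1..r}. a l (n l))"

definition axis_vertex ::
    "nat \<Rightarrow> (nat \<Rightarrow> nat) \<Rightarrow> (nat \<Rightarrow> nat \<Rightarrow> 'a) \<Rightarrow> nat \<Rightarrow> nat \<Rightarrow> (nat \<Rightarrow> 'a)" where
  "axis_vertex r n a i j = (top_vertex r n a)(i := a i j)"

text \<open>The number of pebbles on the top vertex is unconstrained by its own clause. If some
  \<open>n i = 1\<close>, then the top vertex is also the first vertex of the \<open>i\<close>-th axis, and the clause
  for that vertex applies to it.\<close>

definition simple_pebbling ::
    "nat \<Rightarrow> (nat \<Rightarrow> nat) \<Rightarrow> (nat \<Rightarrow> nat \<Rightarrow> 'a) \<Rightarrow> ((nat \<Rightarrow> 'a) \<Rightarrow> nat) \<Rightarrow> bool" where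
  "simple_pebbling r n a S \<longleftrightarrow>
    pebbling_assignment (path_product r n a) S \<and>
    (\<forall>i\<in>{1..r}. S (axis_vertex r n a i 1) \<in> {2, 3}) \<and>
    (\<forall>i\<in>{1..r}. \<forall>j. 1 < j \<and> j < n i \<longrightarrow> S (axis_vertex r n a i j) = 1) \<and>
    (\<forall>v\<in>pverts (path_product r n a).
      v \<noteq> top_vertex r n a \<and>
      (\<forall>i\<in>{1..r}. \<forall>j. 1 \<le> j \<and> j < n i \<longrightarrow> v \<noteq> axis_vertex r n a i j)
      \<longrightarrow> S v \<in> {0, 1})"

end

theory Submission
  imports Defs
begin

text \<open>
  A move changes the assignment only along the axes, the copies of the paths that end in the top
  vertex. The axes act as independent chains of dominoes. On each of them there is at most one
  vertex below the top with two or more pebbles, initially the first one. The only arc leaving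
  that vertex runs along the axis, and a move along it either makes the next vertex the unique
  movable one or reaches the top, from which no arc leaves. So a reachable assignment is
  determined by the position \<open>k i\<close> of the movable vertex on each axis \<open>i\<close> (with \<open>k i = n i\<close> if
  there is none), every such \<open>k\<close> occurs, and a move increments one coordinate of \<open>k\<close>, which
  is also how the arcs of the product act on coordinates.
\<close>

text \<open>An arc here is the pair of its ends, so a vertex map \<open>f\<close> fixes the arc map
  \<open>map_prod f f\<close>. Well-formedness puts both ends among the vertices, where
  \<open>f\<close> is injective.\<close>

lemma digraph_iso_with_projI:
  assumes "pair_wf_digraph G"
    and "inj_on f (pverts G)"
    and "pverts H = f ` pverts G"
    and "parcs H = map_prod f f ` parcs G"
  shows "digraph_iso (with_proj G) (with_proj H)"
proof -
  interpret pair_wf_digraph G by fact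
  let ?h = "\<lparr>iso_verts = f, iso_arcs = map_prod f f, iso_head = snd, iso_tail = fst\<rparr>"
  have "inj_on (map_prod f f) (pverts G \<times> pverts G)"
    using assms(2) by (auto intro: map_prod_inj_on)
  moreover have "parcs G \<subseteq> pverts G \<times> pverts G"
    by (auto dest: in_arcsD1 in_arcsD2)
  ultimately have "inj_on (map_prod f f) (parcs G)"
    by (rule inj_on_subset)
  then have "pre_digraph.digraph_isomorphism (with_proj G) ?h"
    using assms(2) wf_digraph_axioms by (auto simp: pre_digraph.digraph_isomorphism_def)
  moreover have "with_proj H = app_iso ?h (with_proj G)"
    using assms(3,4) by (simp add: app_iso_def with_proj_def)
  ultimately show ?thesis
    unfolding digraph_iso_def by blast
qed

locale simple_pebbled_grid =
  fixes r :: nat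
    and n :: "nat \<Rightarrow> nat"
    and a :: "nat \<Rightarrow> nat \<Rightarrow> 'a"
    and S :: "(nat \<Rightarrow> 'a) \<Rightarrow> nat"
  assumes n_pos: "\<And>i. i \<in> {1..r} \<Longrightarrow> 1 \<le> n i"
    and inj_a: "\<And>i. i \<in> {1..r} \<Longrightarrow> inj_on (a i) {1..n i}"
    and simple: "simple_pebbling r n a S"
begin

abbreviation "G \<equiv> path_product r n a"
abbreviation "axis \<equiv> axis_vertex r n a"
abbreviation "topv \<equiv> top_vertex r n a"

section \<open>Integer coordinates on the product of paths\<close>

definition positions :: "(nat \<Rightarrow> nat) set" where
  "positions = (\<Pi>\<^sub>E i\<in>{1..r}. {1..n i})"

text \<open>One of two parametrisations by the same grid: the isomorphism will send
  \<open>vertex k\<close> to \<open>config k\<close>.\<close>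

definition vertex :: "(nat \<Rightarrow> nat) \<Rightarrow> nat \<Rightarrow> 'a" where
  "vertex k = (\<lambda>i\<in>{1..r}. a i (k i))"

lemma a_eq_iff:
  "\<lbrakk>i \<in> {1..r}; 1 \<le> j; j \<le> n i; 1 \<le> j'; j' \<le> n i\<rbrakk> \<Longrightarrow> a i j = a i j' \<longleftrightarrow> j = j'"
  using inj_onD[OF inj_a, of i j j'] by auto

lemma positionsD:
  "k \<in> positions \<Longrightarrow> i \<in> {1..r} \<Longrightarrow> 1 \<le> k i"
  "k \<in> positions \<Longrightarrow> i \<in> {1..r} \<Longrightarrow> k i \<le> n i"
  using PiE_mem[of k "{1..r}" "\<lambda>i. {1..n i}" i] by (auto simp: positions_def)

lemma positions_eqI:
  assumes "k \<in> positions" "k' \<in> positions" "\<And>i. i \<in> {1..r} \<Longrightarrow> k i = k' i"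
  shows "k = k'"
  using assms unfolding positions_def by (rule PiE_ext)

lemma positions_incr:
  "\<lbrakk>k \<in> positions; i \<in> {1..r}; k i < n i\<rbrakk> \<Longrightarrow> k(i := Suc (k i)) \<in> positions"
  by (auto simp: positions_def PiE_iff extensional_def)

lemma vertex_update: "i \<in> {1..r} \<Longrightarrow> vertex (k(i := j)) = (vertex k)(i := a i j)"
  by (auto simp: vertex_def)

lemma inj_on_vertex: "inj_on vertex positions"
proof (rule inj_onI)
  fix k k' assume k: "k \<in> positions" "k' \<in> positions" and eq: "vertex k = vertex k'"
  have "k i = k' i" if "i \<in> {1..r}" for i
    using fun_cong[OF eq, of i] a_eq_iff[of i "k i" "k' i"] that k positionsD[of k i]
      positionsD[of k' i]
    by (simp add: vertex_def)
  then show "k = k'"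
    using positions_eqI k by blast
qed

lemma pverts_product: "pverts G = vertex ` positions"
proof (intro equalityI subsetI)
  fix x assume "x \<in> pverts G"
  then have x: "x \<in> (\<Pi>\<^sub>E i\<in>{1..r}. a i ` {1..n i})"
    by (simp add: path_product_def cartesian_product_def oriented_path_def)
  then have "\<forall>i\<in>{1..r}. \<exists>j. j \<in> {1..n i} \<and> x i = a i j"
    unfolding PiE_iff by blast
  then obtain k where k: "\<forall>i\<in>{1..r}. k i \<in> {1..n i} \<and> x i = a i (k i)"
    by metis
  \<comment> \<open>The chosen \<open>k\<close> is arbitrary outside \<open>{1..r}\<close>, whereas
    positions are extensional.\<close>
  have "vertex (restrict k {1..r}) = x"
    using k x by (auto simp: vertex_def PiE_iff extensional_def)
  moreover have "restrict k {1..r} \<in> positions"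
    using k by (auto simp: positions_def)
  ultimately show "x \<in> vertex ` positions" by blast
next
  fix x assume "x \<in> vertex ` positions"
  then show "x \<in> pverts G"
    by (auto simp: path_product_def cartesian_product_def oriented_path_def vertex_def
        positions_def PiE_iff)
qed

lemma parcs_product:
  "parcs G = {(vertex k, vertex (k(i := Suc (k i)))) | k i. k \<in> positions \<and> i \<in> {1..r} \<and> k i < n i}"
  (is "_ = ?R")
proof (intro equalityI subrelI)
  fix x y assume xy: "(x, y) \<in> parcs G"
  then have "x \<in> vertex ` positions" "y \<in> vertex ` positions"
    by (auto simp: pverts_product[symmetric] path_product_def cartesian_product_def)
  then obtain k k' where k: "k \<in> positions" "x = vertex k" "k' \<in> positions" "y = vertex k'"
    by blast
  obtain i j where i: "i \<in> {1..r}" "x i = a i j" "y i = a i (Suc j)" "1 \<le> j" "j < n i"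
      "\<forall>l\<in>{1..r} - {i}. x l = y l"
    using xy by (auto simp: path_product_def cartesian_product_def oriented_path_def)
  \<comment> \<open>Injectivity of \<open>a i\<close> recovers the indices from the labels.\<close>
  have "k i = j" "k' i = Suc j"
    using i k a_eq_iff[of i "k i" j] a_eq_iff[of i "k' i" "Suc j"]
      positionsD[of k i] positionsD[of k' i]
    by (auto simp: vertex_def)
  have "y l = (x(i := a i (Suc j))) l" for l
    using i k by (cases "l \<in> {1..r}") (auto simp: vertex_def)
  then have "y = x(i := a i (Suc j))" by blast
  with k i \<open>k i = j\<close> have "y = vertex (k(i := Suc (k i)))"
    by (simp add: vertex_update)
  moreover have "k i < n i"
    using i \<open>k i = j\<close> by simp
  ultimately show "(x, y) \<in> ?R"
    using k(1,2) i(1) by blast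
next
  fix x y assume "(x, y) \<in> ?R"
  then obtain k i where k: "k \<in> positions" "i \<in> {1..r}" "k i < n i"
      "x = vertex k" "y = vertex (k(i := Suc (k i)))" by blast
  have "x \<in> pverts G" "y \<in> pverts G"
    using k positions_incr by (auto simp: pverts_product)
  moreover have "(x i, y i) \<in> parcs (oriented_path (a i) (n i))"
    using k positionsD[of k i] by (auto simp: vertex_def oriented_path_def)
  moreover have "\<forall>l\<in>{1..r} - {i}. x l = y l"
    using k by (auto simp: vertex_def)
  ultimately show "(x, y) \<in> parcs G"
    using k(2) by (auto simp: path_product_def cartesian_product_def)
qed

lemma pair_wf_digraph_product: "pair_wf_digraph G"
  by unfold_locales (auto simp: parcs_product pverts_product positions_incr)

section \<open>The axes and the arcs leaving them\<close>

lemma axis_last: "i \<in> {1..r} \<Longrightarrow> axis i (n i) = topv"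
  by (auto simp: axis_vertex_def top_vertex_def)

text \<open>Distinct axes meet only in the top vertex, so a strict bound on one of the two indices
  suffices. Coordinate \<open>i\<close> tells the vertices apart.\<close>

lemma axis_eq_iff:
  assumes "i \<in> {1..r}" "1 \<le> j" "j < n i" "i' \<in> {1..r}" "1 \<le> j'" "j' \<le> n i'"
  shows "axis i j = axis i' j' \<longleftrightarrow> i = i' \<and> j = j'"
proof
  assume eq: "axis i j = axis i' j'"
  show "i = i' \<and> j = j'"
    using fun_cong[OF eq, of i] assms a_eq_iff[of i j "n i"] a_eq_iff[of i j j']
    by (auto simp: axis_vertex_def top_vertex_def split: if_splits)
qed simp

definition axis_position :: "nat \<Rightarrow> nat \<Rightarrow> nat \<Rightarrow> nat" where
  "axis_position i j = (restrict n {1..r})(i := j)"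

lemma axis_eq_vertex: "i \<in> {1..r} \<Longrightarrow> axis i j = vertex (axis_position i j)"
  by (auto simp: axis_vertex_def top_vertex_def vertex_def axis_position_def)

lemma axis_position_in_positions:
  "\<lbrakk>i \<in> {1..r}; 1 \<le> j; j \<le> n i\<rbrakk> \<Longrightarrow> axis_position i j \<in> positions"
  using n_pos by (auto simp: axis_position_def positions_def PiE_iff extensional_def)

text \<open>All coordinates other than \<open>i\<close> are already maximal, so an arc can only
  raise coordinate \<open>i\<close>.\<close>

lemma arc_from_axis_iff:
  assumes "i \<in> {1..r}" "1 \<le> j" "j < n i"
  shows "(axis i j, w) \<in> parcs G \<longleftrightarrow> w = axis i (Suc j)"
proof
  assume "(axis i j, w) \<in> parcs G"
  then obtain k l where k: "k \<in> positions" "l \<in> {1..r}" "k l < n l"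
      "vertex (axis_position i j) = vertex k" "w = vertex (k(l := Suc (k l)))"
    using assms by (auto simp: parcs_product axis_eq_vertex)
  have "k = axis_position i j"
    using k inj_on_vertex axis_position_in_positions[of i j] assms by (auto dest: inj_onD)
  then have "l = i"
    using k by (auto simp: axis_position_def split: if_splits)
  then show "w = axis i (Suc j)"
    using k \<open>k = axis_position i j\<close> assms by (simp add: axis_eq_vertex axis_position_def)
next
  assume w: "w = axis i (Suc j)"
  let ?k = "axis_position i j"
  have "w = vertex (?k(i := Suc (?k i)))"
    using w assms(1) by (simp add: axis_eq_vertex axis_position_def)
  moreover have "?k \<in> positions" "?k i < n i"
    using assms axis_position_in_positions by (auto simp: axis_position_def)
  ultimately have "(vertex ?k, w) \<in> parcs G"
    using assms(1) unfolding parcs_product by blast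
  then show "(axis i j, w) \<in> parcs G"
    using assms(1) by (simp add: axis_eq_vertex)
qed

lemma no_arc_from_top: "(topv, w) \<notin> parcs G"
proof
  assume "(topv, w) \<in> parcs G"
  then obtain k l where k: "k \<in> positions" "l \<in> {1..r}" "k l < n l" "topv = vertex k"
    by (auto simp: parcs_product)
  have "a l (k l) = a l (n l)"
    using fun_cong[OF k(4), of l] k(2) by (simp add: vertex_def top_vertex_def)
  then show False
    using k a_eq_iff[of l "k l" "n l"] positionsD[of k l] by auto
qed

section \<open>Pebble counts of the initial assignment\<close>

lemma first_pebbles: "i \<in> {1..r} \<Longrightarrow> S (axis i 1) = 2 \<or> S (axis i 1) = 3"
  using simple unfolding simple_pebbling_def by blast

lemma axis_pebbles: "\<lbrakk>i \<in> {1..r}; 1 < j; j < n i\<rbrakk> \<Longrightarrow> S (axis i j) = 1"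
  using simple unfolding simple_pebbling_def by blast

lemma off_axis_pebbles:
  assumes "v \<in> pverts G" "v \<noteq> topv"
    and "\<And>i j. \<lbrakk>i \<in> {1..r}; 1 \<le> j; j < n i\<rbrakk> \<Longrightarrow> v \<noteq> axis i j"
  shows "S v \<le> 1"
proof -
  have "S v \<in> {0, 1}"
    using simple assms unfolding simple_pebbling_def by blast
  then show ?thesis by auto
qed

section \<open>Configurations given by positions\<close>

definition passed :: "(nat \<Rightarrow> nat) \<Rightarrow> (nat \<Rightarrow> 'a) set" where
  "passed k = {axis i j | i j. i \<in> {1..r} \<and> 1 \<le> j \<and> j < k i}"

text \<open>A set is needed because all completed axes end in \<open>topv\<close>, which receives
  one pebble from each. The condition \<open>1 < k i\<close> leaves out axes on which no move has
  been made.\<close>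

definition arrived :: "(nat \<Rightarrow> nat) \<Rightarrow> (nat \<Rightarrow> 'a) \<Rightarrow> nat set" where
  "arrived k v = {i \<in> {1..r}. 1 < k i \<and> v = axis i (k i)}"

text \<open>Truncated subtraction is intended: the first vertex of an axis only loses two pebbles, while
  a later passed vertex starts with one pebble, receives one and loses two, so it ends up with
  \<open>0 = 1 - 2\<close>.\<close>

definition config :: "(nat \<Rightarrow> nat) \<Rightarrow> (nat \<Rightarrow> 'a) \<Rightarrow> nat" where
  "config k v = (if v \<in> passed k then S v - 2 else S v + card (arrived k v))"

lemma finite_arrived: "finite (arrived k v)"
  by (simp add: arrived_def)

lemma axis_in_passed_iff:
  assumes "k \<in> positions" "i \<in> {1..r}" "1 \<le> j" "j \<le> n i"
  shows "axis i j \<in> passed k \<longleftrightarrow> j < k i"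
proof
  assume "axis i j \<in> passed k"
  then obtain i' j' where "i' \<in> {1..r}" "1 \<le> j'" "j' < k i'" "axis i' j' = axis i j"
    by (auto simp: passed_def)
  \<comment> \<open>Passed vertices lie strictly below the top, as \<open>axis_eq_iff\<close>
    requires.\<close>
  moreover from this have "j' < n i'"
    using positionsD[of k i'] assms by auto
  ultimately show "j < k i"
    using axis_eq_iff[of i' j' i j] assms by auto
qed (use assms in \<open>auto simp: passed_def\<close>)

lemma arrived_axis:
  assumes "k \<in> positions" "i \<in> {1..r}" "1 \<le> j" "j < n i"
  shows "arrived k (axis i j) = (if 1 < j \<and> j = k i then {i} else {})"
proof -
  have "axis i j = axis l (k l) \<longleftrightarrow> i = l \<and> j = k l" if "l \<in> {1..r}" for l
    using axis_eq_iff assms positionsD[OF assms(1) that] that by blast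
  then show ?thesis
    using assms(2) by (auto simp: arrived_def)
qed

text \<open>Before \<open>k i\<close> at most \<open>3 - 2\<close> pebbles remain. At
  \<open>k i\<close> there are the initial 2 or 3, or \<open>1 + 1\<close> after an arrival. Beyond
  \<open>k i\<close> the single initial pebble is untouched.\<close>

lemma config_axis:
  assumes "k \<in> positions" "i \<in> {1..r}" "1 \<le> j" "j < n i"
  shows "2 \<le> config k (axis i j) \<longleftrightarrow> j = k i"
proof -
  have "S (axis i j) = (if j = 1 then S (axis i 1) else 1)"
    using axis_pebbles assms by auto
  then show ?thesis
    using assms first_pebbles[of i] positionsD(1)[of k i]
    by (auto simp: config_def axis_in_passed_iff arrived_axis)
qed

lemma inj_on_config: "inj_on config positions"
proof (rule inj_onI)
  fix k k' assume k: "k \<in> positions" "k' \<in> positions" and eq: "config k = config k'"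
  have "k i = k' i" if i: "i \<in> {1..r}" for i
  proof -
    have "j = k i \<longleftrightarrow> j = k' i" if "1 \<le> j" "j < n i" for j
      using config_axis[OF k(1) i that] config_axis[OF k(2) i that] eq by simp
    \<comment> \<open>If either position is below \<open>n i\<close>, the equivalence identifies
      them; otherwise both equal \<open>n i\<close>.\<close>
    from this[of "k i"] this[of "k' i"] show ?thesis
      using positionsD[OF k(1) i] positionsD[OF k(2) i] by linarith
  qed
  then show "k = k'"
    using positions_eqI k by blast
qed

section \<open>Moves between configurations\<close>

lemma config_movable:
  assumes k: "k \<in> positions" and arc: "(v, w) \<in> parcs G" and two: "2 \<le> config k v"
  obtains i where "i \<in> {1..r}" "k i < n i" "v = axis i (k i)" "w = axis i (Suc (k i))"
proof -
  have v: "v \<in> pverts G" "v \<noteq> topv"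
    using arc pair_wf_digraph.in_arcsD1[OF pair_wf_digraph_product] no_arc_from_top by auto
  \<comment> \<open>A vertex off all axes starts with at most one pebble and never receives another,
    so it cannot be moved from.\<close>
  have "\<exists>i j. i \<in> {1..r} \<and> 1 \<le> j \<and> j < n i \<and> v = axis i j"
  proof (rule ccontr)
    assume off: "\<not> ?thesis"
    then have "S v \<le> 1"
      using off_axis_pebbles[OF v] by blast
    moreover have "arrived k v = {}"
    proof -
      have "v \<noteq> axis i (k i)" if "i \<in> {1..r}" for i
        using off v(2) axis_last[OF that] positionsD[OF k that] that
        by (metis le_neq_implies_less)
      then show ?thesis by (auto simp: arrived_def)
    qed
    ultimately show False
      using two by (auto simp: config_def split: if_splits)
  qed
  then obtain i j where i: "i \<in> {1..r}" "1 \<le> j" "j < n i" "v = axis i j" by blast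
  then have "j = k i"
    using config_axis[OF k] two by blast
  then show thesis
    using that[of i] i arc arc_from_axis_iff by blast
qed

lemma config_incr:
  assumes k: "k \<in> positions" and i: "i \<in> {1..r}" and less: "k i < n i"
  defines "v \<equiv> axis i (k i)" and "w \<equiv> axis i (Suc (k i))"
  shows "config (k(i := Suc (k i))) =
    (config k)(v := config k v - 2, w := config k w + 1)"
proof
  fix u
  let ?k = "k(i := Suc (k i))"
  have k': "?k \<in> positions"
    using positions_incr[OF k i less] .
  have pos: "1 \<le> k i"
    using positionsD[OF k i] by simp
  have vw: "v \<noteq> w"
    using axis_eq_iff[of i "k i" i "Suc (k i)"] i less pos by (simp add: v_def w_def)
  have passed: "passed ?k = insert v (passed k)"
    using i pos by (auto simp: passed_def v_def less_Suc_eq split: if_splits)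
  \<comment> \<open>Index \<open>i\<close> leaves the set at \<open>v\<close> and joins the one at
    \<open>w\<close>; there the test \<open>1 < ?k i\<close> holds because \<open>k i\<close> is at
    least 1.\<close>
  have arrived: "arrived ?k u = (if u = w then insert i (arrived k u) else arrived k u - {i})"
    using i pos by (auto simp: arrived_def w_def split: if_splits)
  show "config ?k u = ((config k)(v := config k v - 2, w := config k w + 1)) u"
  proof (cases "u = v")
    case True
    \<comment> \<open>If \<open>k i = 1\<close>, nothing has arrived at \<open>v\<close> and both
      counts below are \<open>S v - 2\<close>. Otherwise both are 0, as \<open>1 - 2\<close> and as
      \<open>1 + 1 - 2\<close>.\<close>
    have "S v = 1" if "k i \<noteq> 1"
      using axis_pebbles i less pos that by (auto simp: v_def)
    then have "S v - 2 = S v + card (arrived k v) - 2"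
      using arrived_axis[OF k i pos less] by (auto simp: v_def)
    moreover have "v \<notin> passed k"
      using axis_in_passed_iff[OF k i pos] less by (simp add: v_def)
    ultimately show ?thesis
      using True vw by (simp add: config_def passed)
  next
    case False
    show ?thesis
    proof (cases "u = w")
      case True
      have "w \<notin> passed ?k"
        using axis_in_passed_iff[OF k' i, of "Suc (k i)"] less by (simp add: w_def)
      \<comment> \<open>The cardinality thus grows by exactly one, even if \<open>w\<close> is the
        top and other axes have already delivered there.\<close>
      moreover have "i \<notin> arrived k w"
        using vw by (auto simp: arrived_def v_def)
      ultimately show ?thesis
        using True vw arrived finite_arrived by (simp add: config_def passed)
    next
      case ne: False
      have "i \<notin> arrived k u"
        using False by (auto simp: arrived_def v_def)
      then show ?thesis
        using False ne arrived by (simp add: config_def passed)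
    qed
  qed
qed

lemma pebbling_move_config_iff:
  assumes k: "k \<in> positions"
  shows "pebbling_move G (config k) B \<longleftrightarrow>
    (\<exists>i\<in>{1..r}. k i < n i \<and> B = config (k(i := Suc (k i))))"
proof -
  \<comment> \<open>A move adds to the assignment already reduced at \<open>v\<close>, while
    \<open>config_incr\<close> reads both old values; \<open>v \<noteq> w\<close> reconciles the two
    forms.\<close>
  have update: "((config k)(v := config k v - 2))(w := ((config k)(v := config k v - 2)) w + 1) =
      config (k(i := Suc (k i)))"
    if "i \<in> {1..r}" "k i < n i" "v = axis i (k i)" "w = axis i (Suc (k i))" for i v w
  proof -
    have "v \<noteq> w"
      using axis_eq_iff[of i "k i" i "Suc (k i)"] that positionsD[OF k] by simp
    then show ?thesis
      using config_incr[OF k that(1,2)] that(3,4) by simp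
  qed
  show ?thesis
  proof
    assume "pebbling_move G (config k) B"
    then obtain v w where vw: "(v, w) \<in> parcs G" "2 \<le> config k v"
        "B = ((config k)(v := config k v - 2))(w := ((config k)(v := config k v - 2)) w + 1)"
      unfolding pebbling_move_def Let_def by blast
    from config_movable[OF k vw(1,2)] obtain i
      where "i \<in> {1..r}" "k i < n i" "v = axis i (k i)" "w = axis i (Suc (k i))" .
    with update vw(3) show "\<exists>i\<in>{1..r}. k i < n i \<and> B = config (k(i := Suc (k i)))"
      by metis
  next
    assume "\<exists>i\<in>{1..r}. k i < n i \<and> B = config (k(i := Suc (k i)))"
    then obtain i where i: "i \<in> {1..r}" "k i < n i" "B = config (k(i := Suc (k i)))" by blast
    have "(axis i (k i), axis i (Suc (k i))) \<in> parcs G" "2 \<le> config k (axis i (k i))"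
      using arc_from_axis_iff config_axis[OF k] i positionsD[OF k] by auto
    then show "pebbling_move G (config k) B"
      unfolding pebbling_move_def Let_def i(3) update[OF i(1,2) refl refl, symmetric] by blast
  qed
qed

section \<open>Reachable assignments\<close>

definition origin :: "nat \<Rightarrow> nat" where
  "origin = (\<lambda>i\<in>{1..r}. 1)"

lemma origin_in_positions: "origin \<in> positions"
  using n_pos by (auto simp: origin_def positions_def)

lemma config_origin: "config origin = S"
  by (auto simp: config_def passed_def arrived_def origin_def)

text \<open>Induction on the coordinate sum: away from the origin some coordinate exceeds 1, and
  lowering it gives a configuration one move earlier.\<close>

lemma reachable_config:
  assumes "k \<in> positions"
  shows "(pebbling_move G)\<^sup>*\<^sup>* S (config k)"
  using assms
proof (induction "\<Sum>i\<in>{1..r}. k i" arbitrary: k)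
  case 0
  \<comment> \<open>Coordinates are at least 1, so sum 0 means \<open>r = 0\<close>. For positive
    \<open>r\<close> the origin is met in the induction step.\<close>
  then have "\<not> 1 \<le> r"
    using positionsD(1)[of k 1] by auto
  then have "k = origin"
    using 0 by (auto simp: positions_def origin_def)
  then show ?case by (simp add: config_origin)
next
  case (Suc m)
  show ?case
  proof (cases "k = origin")
    case True
    then show ?thesis by (simp add: config_origin)
  next
    case False
    then obtain i where "i \<in> {1..r}" "k i \<noteq> origin i"
      using positions_eqI[OF Suc.prems origin_in_positions] by blast
    then have i: "i \<in> {1..r}" "k i \<noteq> 1"
      by (auto simp: origin_def)
    let ?k = "k(i := k i - 1)"
    have ki: "1 < k i" "k i \<le> n i"
      using positionsD[OF Suc.prems i(1)] i(2) by auto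
    have k': "?k \<in> positions"
      using Suc.prems i(1) ki by (auto simp: positions_def PiE_iff extensional_def
          intro: le_trans[OF diff_le_self])
    have "sum k {1..r} = k i + sum k ({1..r} - {i})"
      using i(1) by (intro sum.remove) auto
    moreover have "sum ?k {1..r} = (k i - 1) + sum k ({1..r} - {i})"
      using i(1) by (subst sum.remove[of _ i]) auto
    ultimately have "m = sum ?k {1..r}"
      using Suc.hyps(2) ki(1) by simp
    then have "(pebbling_move G)\<^sup>*\<^sup>* S (config ?k)"
      using Suc.hyps(1) k' by simp
    moreover have "pebbling_move G (config ?k) (config k)"
      unfolding pebbling_move_config_iff[OF k'] using i(1) ki by (intro bexI[of _ i]) auto
    ultimately show ?thesis by simp
  qed
qed

lemma reachable_imp_config:
  "(pebbling_move G)\<^sup>*\<^sup>* S A \<Longrightarrow> A \<in> config ` positions"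
proof (induction rule: rtranclp_induct)
  case base
  then show ?case
    using config_origin origin_in_positions by force
next
  case (step A B)
  then show ?case
    using pebbling_move_config_iff positions_incr by blast
qed

section \<open>The isomorphism with the assignment graph\<close>

lemma pverts_assignment_graph: "pverts (assignment_graph G S) = config ` positions"
  using reachable_config reachable_imp_config by (auto simp: assignment_graph_def)

lemma parcs_assignment_graph:
  "parcs (assignment_graph G S) =
    {(config k, config (k(i := Suc (k i)))) | k i. k \<in> positions \<and> i \<in> {1..r} \<and> k i < n i}"
  (is "_ = ?R")
proof (intro equalityI subrelI)
  fix A B assume "(A, B) \<in> parcs (assignment_graph G S)"
  then have "A \<in> config ` positions" "pebbling_move G A B"
    using reachable_imp_config by (auto simp: assignment_graph_def)
  then show "(A, B) \<in> ?R"
    using pebbling_move_config_iff by blast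
next
  fix A B assume "(A, B) \<in> ?R"
  then obtain k i where k: "k \<in> positions" "i \<in> {1..r}" "k i < n i"
      "A = config k" "B = config (k(i := Suc (k i)))" by blast
  then have "pebbling_move G A B"
    using pebbling_move_config_iff by blast
  then show "(A, B) \<in> parcs (assignment_graph G S)"
    using k reachable_config positions_incr by (simp add: assignment_graph_def)
qed

lemma digraph_iso_assignment_graph:
  "digraph_iso (with_proj G) (with_proj (assignment_graph G S))"
proof (rule digraph_iso_with_projI[OF pair_wf_digraph_product])
  let ?f = "\<lambda>x. config (the_inv_into positions vertex x)"
  have f: "?f (vertex k) = config k" if "k \<in> positions" for k
    using that by (simp add: the_inv_into_f_f inj_on_vertex)
  show "inj_on ?f (pverts G)"
    unfolding pverts_product by (auto simp: f inj_on_def dest: inj_onD[OF inj_on_config])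
  show "pverts (assignment_graph G S) = ?f ` pverts G"
    unfolding pverts_assignment_graph pverts_product image_image
    by (intro image_cong refl) (simp add: f)
  \<comment> \<open>Both arc sets are images of the same pairs \<open>(k, i)\<close>, so they can be
    compared pair by pair.\<close>
  have "parcs (assignment_graph G S) =
      (\<lambda>(k, i). (config k, config (k(i := Suc (k i))))) `
        {(k, i). k \<in> positions \<and> i \<in> {1..r} \<and> k i < n i}"
    unfolding parcs_assignment_graph by auto
  also have "\<dots> = (\<lambda>(k, i). map_prod ?f ?f (vertex k, vertex (k(i := Suc (k i))))) `
        {(k, i). k \<in> positions \<and> i \<in> {1..r} \<and> k i < n i}"
    by (intro image_cong refl) (auto simp: f positions_incr)
  also have "\<dots> = map_prod ?f ?f ` parcs G"
    unfolding parcs_product by (auto simp: image_iff) blast+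
  finally show "parcs (assignment_graph G S) = map_prod ?f ?f ` parcs G" .
qed

end

theorem theorem7p1:
  fixes r :: nat
    and n :: "nat \<Rightarrow> nat"
    and a :: "nat \<Rightarrow> nat \<Rightarrow> 'a"
    and S :: "(nat \<Rightarrow> 'a) \<Rightarrow> nat"
  assumes "\<And>i. i \<in> {1..r} \<Longrightarrow> 1 \<le> n i"
    and "\<And>i. i \<in> {1..r} \<Longrightarrow> inj_on (a i) {1..n i}"
    and "simple_pebbling r n a S"
  shows "digraph_iso (with_proj (path_product r n a))
    (with_proj (assignment_graph (path_product r n a) S))"
proof -
  interpret simple_pebbled_grid r n a S
    by unfold_locales fact+
  show ?thesis
    by (rule digraph_iso_assignment_graph)
qed

end
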